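(* Let $Y$ be a univariate response and $X\in\mathbb{R}^p$ a random predictor with mean $\mu=E(X)$ and covariance matrix $\Sigma=\mathrm{Var}(X)$. For $\tau\in(0,1)$ and a fixed $\lambda>0$ let $$L_\tau(\alpha,\beta)=\beta^\top\Sigma\beta+\lambda\,E\left[\rho_\tau\{Y-\alpha-\beta^\top(X-\mu)\}\right],\qquad \alpha\in\mathbb{R},\ \beta\in\mathbb{R}^p .$$ Suppose $E(X\mid B^\top X)$ is linear in $B^\top X$, where $B\in\mathbb{R}^{p\times d}$ is a basis of the central space $\mathcal{S}_{Y|X}$. Let $0<\tau_1<\ldots<\tau_K<1$ and $$(\alpha_{0,\tau_k},\beta_{0,\tau_k})=\underset{\alpha\in\mathbb{R},\ \beta\in\mathbb{R}^p}{\operatorname{argmin}}\ L_{\tau_k}(\alpha,\beta)\quad\text{for }k=1,\ldots,K.$$ Then $\mathrm{span}(\Lambda)\subseteq\mathcal{S}_{Y|X}$, where $\Lambda=\sum_{k=1}^K\beta_{0,\tau_k}\beta_{0,\tau_k}^\top$.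
   Context: $\mathrm{span}(\cdot)$ denotes the column space of a matrix. The asymmetric least squares loss is $\rho_\tau(c)=(1-\tau)c^2$ if $c\le 0$ and $\rho_\tau(c)=\tau c^2$ if $c>0$. A dimension reduction space is the column space of a matrix $B$ such that $Y$ and $X$ are conditionally independent given $B^\top X$. The central space $\mathcal{S}_{Y|X}$ is the intersection of all dimension reduction spaces; it is assumed throughout that this intersection is itself a dimension reduction space. In particular, if the columns of $B\in\mathbb{R}^{p\times d}$ form a basis of $\mathcal{S}_{Y|X}$, then $Y$ and $X$ are conditionally independent given $B^\top X$. "Linear in $B^\top X$" is the usual linear conditional mean condition of the sufficient dimension reduction literature: $E(X\mid B^\top X)=c+MB^\top X$ for some fixed vector $c$ and matrix $M$. The moments appearing in $L_\tau$ are taken to be finite, and each displayed argmin denotes the minimizer, which is presupposed to be well defined. *)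

theory Defs
  imports "HOL-Probability.Probability"
begin

definition als_loss :: "real \<Rightarrow> real \<Rightarrow> real" where
  "als_loss \<tau> c = (if c \<le> 0 then (1 - \<tau>) * c\<^sup>2 else \<tau> * c\<^sup>2)"

definition covariance_matrix :: "'a measure \<Rightarrow> ('a \<Rightarrow> real ^ 'p) \<Rightarrow> real ^ 'p ^ 'p" where
  "covariance_matrix M X =
    (let \<mu> = integral\<^sup>L M X
     in \<chi> i j. integral\<^sup>L M (\<lambda>\<omega>. (X \<omega> $ i - \<mu> $ i) * (X \<omega> $ j - \<mu> $ j)))"

definition als_objective ::
  "'a measure \<Rightarrow> ('a \<Rightarrow> real) \<Rightarrow> ('a \<Rightarrow> real ^ 'p) \<Rightarrow> real \<Rightarrow> real
    \<Rightarrow> real \<times> (real ^ 'p) \<Rightarrow> real" where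
  "als_objective M Y X lam \<tau> = (\<lambda>(\<alpha>, \<beta>).
    \<beta> \<bullet> (covariance_matrix M X *v \<beta>)
    + lam * integral\<^sup>L M (\<lambda>\<omega>. als_loss \<tau> (Y \<omega> - \<alpha> - \<beta> \<bullet> (X \<omega> - integral\<^sup>L M X))))"

text \<open>
  The number \<open>d\<close> of columns of a matrix \<open>B\<close> has to range over all natural numbers, including
  \<open>0\<close> (the central space is \<open>{0}\<close> when \<open>Y\<close> and \<open>X\<close> are independent).  A \<open>p \<times> d\<close> matrix is
  therefore given by its columns \<open>B 0, \<dots>, B (d - 1)\<close>; the values \<open>B j\<close> with \<open>j \<ge> d\<close> are
  irrelevant.
\<close>

definition col_space :: "nat \<Rightarrow> (nat \<Rightarrow> real ^ 'p) \<Rightarrow> (real ^ 'p) set" where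
  "col_space d B = span (B ` {..<d})"

definition cols_basis :: "nat \<Rightarrow> (nat \<Rightarrow> real ^ 'p) \<Rightarrow> (real ^ 'p) set \<Rightarrow> bool" where
  "cols_basis d B S \<longleftrightarrow>
    inj_on B {..<d} \<and> independent (B ` {..<d}) \<and> col_space d B = S"

text \<open>The \<open>\<sigma>\<close>-algebra generated by the \<open>d\<close>-dimensional random vector \<open>B\<^sup>T X\<close>.\<close>

definition sigma_proj ::
  "'a measure \<Rightarrow> ('a \<Rightarrow> real ^ 'p) \<Rightarrow> nat \<Rightarrow> (nat \<Rightarrow> real ^ 'p) \<Rightarrow> 'a measure" where
  "sigma_proj M X d B =
    vimage_algebra (space M) (\<lambda>\<omega>. \<lambda>j\<in>{..<d}. B j \<bullet> X \<omega>) (PiM {..<d} (\<lambda>_. borel))"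

definition cond_indep ::
  "'a measure \<Rightarrow> 'a measure \<Rightarrow> ('a \<Rightarrow> 'b::topological_space) \<Rightarrow> ('a \<Rightarrow> 'c::topological_space)
    \<Rightarrow> bool" where
  "cond_indep M F Y X \<longleftrightarrow>
    (\<forall>A\<in>sets borel. \<forall>C\<in>sets borel. AE \<omega> in M.
      real_cond_exp M F (\<lambda>\<omega>. indicator A (Y \<omega>) * indicator C (X \<omega>)) \<omega>
      = real_cond_exp M F (\<lambda>\<omega>. indicator A (Y \<omega>)) \<omega>
        * real_cond_exp M F (\<lambda>\<omega>. indicator C (X \<omega>)) \<omega>)"

definition dim_reduction_space ::
  "'a measure \<Rightarrow> ('a \<Rightarrow> real) \<Rightarrow> ('a \<Rightarrow> real ^ 'p) \<Rightarrow> (real ^ 'p) set \<Rightarrow> bool" where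
  "dim_reduction_space M Y X S \<longleftrightarrow>
    (\<exists>d B. S = col_space d B \<and> cond_indep M (sigma_proj M X d B) Y X)"

definition central_space ::
  "'a measure \<Rightarrow> ('a \<Rightarrow> real) \<Rightarrow> ('a \<Rightarrow> real ^ 'p) \<Rightarrow> (real ^ 'p) set" where
  "central_space M Y X = \<Inter> {S. dim_reduction_space M Y X S}"

text \<open>
  \<open>E(X | B\<^sup>T X) = c + A B\<^sup>T X\<close> almost surely, coordinate by coordinate; \<open>A\<close> is again a
  \<open>p \<times> d\<close> matrix given by its columns.
\<close>

definition linear_cond_mean ::
  "'a measure \<Rightarrow> ('a \<Rightarrow> real ^ 'p) \<Rightarrow> nat \<Rightarrow> (nat \<Rightarrow> real ^ 'p) \<Rightarrow> bool" where
  "linear_cond_mean M X d B \<longleftrightarrow>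
    (\<exists>(c :: real ^ 'p) (A :: nat \<Rightarrow> real ^ 'p). \<forall>i. AE \<omega> in M.
      real_cond_exp M (sigma_proj M X d B) (\<lambda>\<omega>. X \<omega> $ i) \<omega>
      = c $ i + (\<Sum>j<d. A j $ i * (B j \<bullet> X \<omega>)))"

definition outer_product :: "real ^ 'p \<Rightarrow> real ^ 'p \<Rightarrow> real ^ 'p ^ 'p" where
  "outer_product u v = (\<chi> i j. u $ i * v $ j)"

end

theory Submission
  imports Defs
begin

text \<open>
  Replacing \<open>\<beta>\<close> by the \<open>\<gamma>\<close> in the central space with
  \<open>\<gamma>\<^sup>T (X - \<mu>) = E (\<beta>\<^sup>T (X - \<mu>) | B\<^sup>T X)\<close>, which exists by the linear conditional mean, does not
  increase the objective: by conditional independence this is also the conditional expectation of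
  \<open>\<beta>\<^sup>T (X - \<mu>)\<close> given \<open>(Y, B\<^sup>T X)\<close>, so Jensen's inequality applies to the convex loss and to the
  variance.  Uniqueness of the minimizer gives \<open>\<beta> = \<gamma>\<close>.
\<close>

section \<open>Projections of the predictor\<close>

lemma inner_measurable_sigma_proj:
  assumes "j < d"
  shows "(\<lambda>\<omega>. B j \<bullet> X \<omega>) \<in> borel_measurable (sigma_proj M X d B)"
proof -
  have "(\<lambda>\<omega>. \<lambda>j\<in>{..<d}. B j \<bullet> X \<omega>) \<in> sigma_proj M X d B \<rightarrow>\<^sub>M PiM {..<d} (\<lambda>_. borel)"
    unfolding sigma_proj_def by (rule measurable_vimage_algebra1) (auto simp: space_PiM)
  from measurable_compose[OF this measurable_component_singleton[of j "{..<d}"]] assms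
  show ?thesis by simp
qed

text \<open>Inner products with \<open>X\<close> are linear in the vector, so those with vectors of
  the span are measurable for the generated sigma-algebra, and each family generates what the other
  does. This moves conditional independence from whichever columns witness a dimension reduction
  space to a chosen basis of it.\<close>

lemma sigma_proj_eq_span:
  fixes X :: "'a \<Rightarrow> real ^ 'p" and B B' :: "nat \<Rightarrow> real ^ 'p"
  assumes "col_space d B = col_space d' B'"
  shows "sigma_proj M X d B = sigma_proj M X d' B'"
proof -
  have meas: "(\<lambda>\<omega>. v \<bullet> X \<omega>) \<in> borel_measurable (sigma_proj M X d B)"
    if "v \<in> col_space d B" for v d and B :: "nat \<Rightarrow> real ^ 'p"
    using that unfolding col_space_def
  proof (induction rule: span_induct_alt)
    case base
    show ?case by simp
  next
    case (step c x y)
    then obtain j where j: "j < d" "x = B j" by auto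
    then have "(\<lambda>\<omega>. x \<bullet> X \<omega>) \<in> borel_measurable (sigma_proj M X d B)"
      using inner_measurable_sigma_proj[of j d B X M] by simp
    with step.IH show ?case by (simp add: inner_add_left)
  qed
  have sub: "sets (sigma_proj M X d B) \<subseteq> sets (sigma_proj M X d' B')"
    if "col_space d B = col_space d' B'" for d d' and B B' :: "nat \<Rightarrow> real ^ 'p"
  proof -
    have "B j \<in> col_space d' B'" if "j < d" for j
      using that \<open>col_space d B = col_space d' B'\<close> unfolding col_space_def
      by (metis imageI lessThan_iff span_base)
    then have "(\<lambda>\<omega>. \<lambda>j\<in>{..<d}. B j \<bullet> X \<omega>) \<in> sigma_proj M X d' B' \<rightarrow>\<^sub>M PiM {..<d} (\<lambda>_. borel)"
      by (intro measurable_restrict meas) auto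
    then show ?thesis
      unfolding sigma_proj_def[of M X d B] by (intro sets_image_in_sets) (auto simp: sigma_proj_def)
  qed
  show ?thesis
  proof (rule measure_eqI)
    show "sets (sigma_proj M X d B) = sets (sigma_proj M X d' B')"
      using sub assms by (metis subset_antisym)
  \<comment> \<open>Equality as measures also compares the mass functions; both are zero, since
    \<open>vimage_algebra\<close> carries the null measure.\<close>
  qed (simp add: sigma_proj_def vimage_algebra_def emeasure_sigma)
qed

lemma sets_sigma_proj_subset:
  "sets (sigma_proj M X d B) \<subseteq> sets (vimage_algebra (space M) X borel)"
proof -
  have [measurable]: "X \<in> borel_measurable (vimage_algebra (space M) X borel)"
    by (rule measurable_vimage_algebra1) auto
  show ?thesis
    unfolding sigma_proj_def by (rule sets_image_in_sets) auto
qed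

section \<open>Conditional independence\<close>

text \<open>Conditional independence makes P = E(1_A(Y) | F) also the conditional expectation of
  1_A(Y) given all of \<open>X\<close>. Hence 1_A(Y) may be replaced by P next to the X-measurable
  \<open>W\<close>, then \<open>W\<close> by its projection \<open>V\<close> next to the
  F-measurable P, and finally P by 1_A(Y) again.\<close>

lemma cond_indep_integral_eq:
  fixes X :: "'a \<Rightarrow> 'b::topological_space" and Y :: "'a \<Rightarrow> 'c::topological_space"
  assumes "prob_space M"
    and F: "subalgebra M F" and GX: "subalgebra M G" and FG: "sets F \<subseteq> sets G"
    and G_def: "G = vimage_algebra (space M) X borel"
    and [measurable]: "Y \<in> borel_measurable M" "X \<in> borel_measurable M"
    and ci: "cond_indep M F Y X"
    and W: "integrable M W" "W \<in> borel_measurable G"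
    and V: "V \<in> borel_measurable F" "AE \<omega> in M. real_cond_exp M F W \<omega> = V \<omega>"
    and A: "A \<in> sets borel" and D: "D \<in> sets F"
  shows "(\<integral>\<omega>. indicator D \<omega> * indicator A (Y \<omega>) * W \<omega> \<partial>M)
    = (\<integral>\<omega>. indicator D \<omega> * indicator A (Y \<omega>) * V \<omega> \<partial>M)"
proof -
  interpret prob_space M by fact
  interpret F: finite_measure_subalgebra M F by standard (fact F)
  interpret G: finite_measure_subalgebra M G by standard (fact GX)
  have spF: "space F = space M" and spG: "space G = space M"
    using F GX by (auto simp: subalgebra_def)
  have FG': "f \<in> borel_measurable G" if "f \<in> borel_measurable F" for f :: "'a \<Rightarrow> real"
    using that FG spF spG by (auto simp: measurable_def)
  note FM = measurable_from_subalg[OF F]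
  note GM = measurable_from_subalg[OF GX]
  note [measurable] = A
  have [measurable]: "W \<in> borel_measurable M" "V \<in> borel_measurable M"
    using W(2) V(1) GM FM by blast+
  have [measurable]: "D \<in> sets M" using D F by (auto simp: subalgebra_def)
  define a :: "'a \<Rightarrow> real" where "a = (\<lambda>\<omega>. indicator A (Y \<omega>))"
  have [measurable]: "a \<in> borel_measurable M" unfolding a_def by measurable
  have a01: "\<bar>a \<omega>\<bar> \<le> 1" for \<omega> by (simp add: a_def indicator_def)
  have int_a: "integrable M a" by (rule integrable_const_bound[where B=1]) (use a01 in auto)
  define P where "P = real_cond_exp M F a"
  have PF [measurable]: "P \<in> borel_measurable F" unfolding P_def by simp
  have PM [measurable]: "P \<in> borel_measurable M" by (rule FM[OF PF])
  have int_P: "integrable M P" unfolding P_def by (rule F.real_cond_exp_int(1)[OF int_a])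
  \<comment> \<open>Sets of \<open>G\<close> are preimages of Borel sets under \<open>X\<close>, so
    integrating over one means multiplying by an indicator of \<open>X\<close>, for which the
    product formula of \<open>cond_indep\<close> is available.\<close>
  have PG: "AE \<omega> in M. real_cond_exp M G a \<omega> = P \<omega>"
  proof (rule G.real_cond_exp_charact)
    fix E assume E: "E \<in> sets G"
    then obtain C where C [measurable]: "C \<in> sets borel" and EC: "E = X -` C \<inter> space M"
      unfolding G_def by (auto simp: sets_vimage_algebra2)
    define x :: "'a \<Rightarrow> real" where "x = (\<lambda>\<omega>. indicator C (X \<omega>))"
    have [measurable]: "x \<in> borel_measurable M" unfolding x_def by measurable
    have int_x: "integrable M x"
      by (rule integrable_const_bound[where B=1]) (auto simp: x_def indicator_def)
    have int_ax: "integrable M (\<lambda>\<omega>. a \<omega> * x \<omega>)"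
      by (rule integrable_const_bound[where B=1]) (auto simp: x_def a_def indicator_def)
    have int_Px: "integrable M (\<lambda>\<omega>. P \<omega> * x \<omega>)"
      by (rule Bochner_Integration.integrable_bound[OF int_P])
        (auto simp: x_def indicator_def)
    have "(\<integral>\<omega>. a \<omega> * x \<omega> \<partial>M) = (\<integral>\<omega>. real_cond_exp M F (\<lambda>\<omega>. a \<omega> * x \<omega>) \<omega> \<partial>M)"
      by (rule F.real_cond_exp_int(2)[OF int_ax, symmetric])
    also have "\<dots> = (\<integral>\<omega>. P \<omega> * real_cond_exp M F x \<omega> \<partial>M)"
    proof (rule integral_cong_AE)
      show "AE \<omega> in M. real_cond_exp M F (\<lambda>\<omega>. a \<omega> * x \<omega>) \<omega> = P \<omega> * real_cond_exp M F x \<omega>"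
        using ci A C unfolding cond_indep_def a_def x_def P_def by blast
    qed auto
    also have "\<dots> = (\<integral>\<omega>. P \<omega> * x \<omega> \<partial>M)"
      by (rule F.real_cond_exp_intg(2)[OF int_Px PF]) simp
    finally have *: "(\<integral>\<omega>. a \<omega> * x \<omega> \<partial>M) = (\<integral>\<omega>. P \<omega> * x \<omega> \<partial>M)" .
    have x: "x \<omega> = indicator E \<omega>" if "\<omega> \<in> space M" for \<omega>
      using that by (simp add: x_def EC indicator_def)
    have "(\<integral>\<omega>\<in>E. a \<omega> \<partial>M) = (\<integral>\<omega>. a \<omega> * x \<omega> \<partial>M)"
      unfolding set_lebesgue_integral_def
      by (rule Bochner_Integration.integral_cong) (auto simp: x mult.commute)
    also have "\<dots> = (\<integral>\<omega>\<in>E. P \<omega> \<partial>M)"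
      unfolding set_lebesgue_integral_def *
      by (rule Bochner_Integration.integral_cong) (auto simp: x mult.commute)
    finally show "(\<integral>\<omega>\<in>E. a \<omega> \<partial>M) = (\<integral>\<omega>\<in>E. P \<omega> \<partial>M)" .
  qed (use int_a int_P FG'[OF PF] in auto)
  have intV: "integrable M V"
    using F.real_cond_exp_int(1)[OF W(1)] V(2) by (subst integrable_cong_AE[symmetric]) auto
  have DF: "(indicator D :: 'a \<Rightarrow> real) \<in> borel_measurable F" using D by simp
  have i1: "integrable M (\<lambda>\<omega>. (indicator D \<omega> * W \<omega>) * a \<omega>)"
    by (rule Bochner_Integration.integrable_bound[OF W(1)])
      (auto simp: a_def indicator_def)
  have i2: "integrable M (\<lambda>\<omega>. (indicator D \<omega> * V \<omega>) * a \<omega>)"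
    by (rule Bochner_Integration.integrable_bound[OF intV])
      (auto simp: a_def indicator_def)
  have DW: "(\<lambda>\<omega>. indicator D \<omega> * W \<omega>) \<in> borel_measurable G"
    using FG'[OF DF] W(2) by simp
  have DV: "(\<lambda>\<omega>. indicator D \<omega> * V \<omega>) \<in> borel_measurable F"
    using DF V(1) by simp
  have DP: "(\<lambda>\<omega>. indicator D \<omega> * P \<omega>) \<in> borel_measurable F"
    using DF PF by simp
  \<comment> \<open>Pulling 1_D W out of the conditional expectation of \<open>a\<close> given
    \<open>G\<close> already yields integrability, so no almost sure bound on \<open>P\<close> has
    to be proved.\<close>
  have i3: "integrable M (\<lambda>\<omega>. (indicator D \<omega> * P \<omega>) * W \<omega>)"
  proof -
    have "integrable M (\<lambda>\<omega>. indicator D \<omega> * W \<omega> * real_cond_exp M G a \<omega>)"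
      by (rule G.real_cond_exp_intg(1)[OF i1 DW]) simp
    then show ?thesis
      by (rule integrable_cong_AE_imp) (use PG in auto)
  qed
  have "(\<integral>\<omega>. (indicator D \<omega> * W \<omega>) * a \<omega> \<partial>M)
      = (\<integral>\<omega>. (indicator D \<omega> * W \<omega>) * real_cond_exp M G a \<omega> \<partial>M)"
    by (rule G.real_cond_exp_intg(2)[OF i1 DW, symmetric]) simp
  also have "\<dots> = (\<integral>\<omega>. (indicator D \<omega> * P \<omega>) * W \<omega> \<partial>M)"
    by (rule integral_cong_AE) (use PG in auto)
  also have "\<dots> = (\<integral>\<omega>. (indicator D \<omega> * P \<omega>) * real_cond_exp M F W \<omega> \<partial>M)"
    by (rule F.real_cond_exp_intg(2)[OF i3 DP, symmetric]) simp
  also have "\<dots> = (\<integral>\<omega>. (indicator D \<omega> * V \<omega>) * real_cond_exp M F a \<omega> \<partial>M)"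
    by (rule integral_cong_AE) (use V(2) in \<open>auto simp: P_def\<close>)
  also have "\<dots> = (\<integral>\<omega>. (indicator D \<omega> * V \<omega>) * a \<omega> \<partial>M)"
    by (rule F.real_cond_exp_intg(2)[OF i2 DV]) simp
  finally show ?thesis by (simp add: a_def mult_ac)
qed

text \<open>\<open>H\<close> is the sigma-algebra generated by \<open>Y\<close> and
  \<open>F\<close>. The preceding identity says that \<open>W\<close> and \<open>V\<close> have
  equal integrals over a generator of \<open>H\<close> that is stable under intersection, and
  Dynkin's argument extends this to all of \<open>H\<close>.\<close>

lemma cond_indep_cond_exp:
  fixes X :: "'a \<Rightarrow> 'b::topological_space" and Y :: "'a \<Rightarrow> 'c::topological_space"
  assumes "prob_space M"
    and F: "subalgebra M F" and GX: "subalgebra M G" and FG: "sets F \<subseteq> sets G"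
    and G_def: "G = vimage_algebra (space M) X borel"
    and Y [measurable]: "Y \<in> borel_measurable M" and X [measurable]: "X \<in> borel_measurable M"
    and ci: "cond_indep M F Y X"
    and W: "integrable M W" "W \<in> borel_measurable G"
    and V: "V \<in> borel_measurable F" "AE \<omega> in M. real_cond_exp M F W \<omega> = V \<omega>"
  obtains H where "subalgebra M H" "sets F \<subseteq> sets H" "Y \<in> borel_measurable H"
    "AE \<omega> in M. real_cond_exp M H W \<omega> = V \<omega>"
proof -
  interpret prob_space M by fact
  interpret F: finite_measure_subalgebra M F by standard (fact F)
  have spF: "space F = space M" and FM: "sets F \<subseteq> sets M"
    using F by (auto simp: subalgebra_def)
  have [measurable]: "V \<in> borel_measurable M" by (rule measurable_from_subalg[OF F V(1)])
  have intV: "integrable M V"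
    using F.real_cond_exp_int(1)[OF W(1)] V(2) W(1) by (subst integrable_cong_AE[symmetric]) auto
  \<comment> \<open>The choice A = UNIV recovers the sets of \<open>F\<close>, and D = the whole
    space recovers the preimages under \<open>Y\<close>; so \<open>H\<close> contains
    \<open>F\<close> and makes \<open>Y\<close> measurable.\<close>
  define Gen where "Gen = {Y -` A \<inter> D |A D. A \<in> sets borel \<and> D \<in> sets F}"
  define H where "H = sigma (space M) Gen"
  have Gen_M: "Gen \<subseteq> sets M"
  proof
    fix E assume "E \<in> Gen"
    then obtain A D where AD: "A \<in> sets borel" "D \<in> sets F" "E = Y -` A \<inter> D"
      by (auto simp: Gen_def)
    then have "E = (Y -` A \<inter> space M) \<inter> D" using FM sets.sets_into_space by blast
    then show "E \<in> sets M" using AD(1,2) FM measurable_sets[OF Y] by auto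
  qed
  have Gen_sp: "Gen \<subseteq> Pow (space M)" using Gen_M sets.space_closed by blast
  have setsH: "sets H = sigma_sets (space M) Gen" and spH: "space H = space M"
    using Gen_sp by (auto simp: H_def)
  have subH: "subalgebra M H"
    unfolding subalgebra_def setsH spH using sets.sigma_sets_subset[OF Gen_M] by simp
  have FH: "sets F \<subseteq> sets H"
  proof
    fix D assume "D \<in> sets F"
    then have "D \<in> Gen" unfolding Gen_def by (intro CollectI exI[of _ UNIV] exI[of _ D]) auto
    then show "D \<in> sets H" by (auto simp: setsH)
  qed
  have YH: "Y \<in> borel_measurable H"
  proof (rule measurableI)
    fix A :: "'c set" assume "A \<in> sets borel"
    then have "Y -` A \<inter> space H \<in> Gen" unfolding Gen_def spH spF[symmetric] by auto
    then show "Y -` A \<inter> space H \<in> sets H" by (auto simp: setsH)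
  qed simp
  have Int: "Int_stable Gen"
  proof (rule Int_stableI)
    fix a b assume "a \<in> Gen" "b \<in> Gen"
    then obtain A D A' D' where "A \<in> sets borel" "D \<in> sets F" "a = Y -` A \<inter> D"
      "A' \<in> sets borel" "D' \<in> sets F" "b = Y -` A' \<inter> D'" by (auto simp: Gen_def)
    then show "a \<inter> b \<in> Gen"
      unfolding Gen_def by (intro CollectI exI[of _ "A \<inter> A'"] exI[of _ "D \<inter> D'"]) auto
  qed
  interpret H: finite_measure_subalgebra M H by standard (fact subH)
  have HM: "E \<in> sets M" if "E \<in> sigma_sets (space M) Gen" for E
    using that subH by (auto simp: subalgebra_def setsH)
  have gen: "(\<integral>\<omega>\<in>E. W \<omega> \<partial>M) = (\<integral>\<omega>\<in>E. V \<omega> \<partial>M)" if "E \<in> Gen" for E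
  proof -
    from that obtain A D where AD: "A \<in> sets borel" "D \<in> sets F" "E = Y -` A \<inter> D"
      by (auto simp: Gen_def)
    then have "indicator E \<omega> = (indicator D \<omega> * indicator A (Y \<omega>) :: real)" for \<omega>
      by (auto simp: indicator_def)
    then show ?thesis
      using cond_indep_integral_eq[OF assms AD(1,2)] by (simp add: set_lebesgue_integral_def)
  qed
  \<comment> \<open>The complement case of the induction subtracts from the total integrals, so
    these must agree.\<close>
  have spW: "(\<integral>\<omega>\<in>space M. W \<omega> \<partial>M) = (\<integral>\<omega>\<in>space M. V \<omega> \<partial>M)"
  proof (rule gen)
    show "space M \<in> Gen"
      unfolding Gen_def spF[symmetric] by (intro CollectI exI[of _ UNIV] exI[of _ "space F"]) auto
  qed
  have si: "set_integrable M E f" if "E \<in> sets M" "integrable M f" for E and f :: "'a \<Rightarrow> real"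
    using that unfolding set_integrable_def by (rule integrable_mult_indicator)
  have "(\<integral>\<omega>\<in>E. W \<omega> \<partial>M) = (\<integral>\<omega>\<in>E. V \<omega> \<partial>M)" if "E \<in> sets H" for E
    using Int Gen_sp that[unfolded setsH]
  proof (induction rule: sigma_sets_induct_disjoint)
    case (basic E)
    then show ?case by (rule gen)
  next
    case empty
    show ?case by (simp add: set_lebesgue_integral_def)
  next
    case (compl E)
    have E: "E \<in> sets M" using HM compl by blast
    have "(\<integral>\<omega>\<in>space M - E. f \<omega> \<partial>M) = (\<integral>\<omega>\<in>space M. f \<omega> \<partial>M) - (\<integral>\<omega>\<in>E. f \<omega> \<partial>M)"
      if "integrable M f" for f :: "'a \<Rightarrow> real"
    proof -
      have "(\<integral>\<omega>\<in>E \<union> (space M - E). f \<omega> \<partial>M) = (\<integral>\<omega>\<in>E. f \<omega> \<partial>M) + (\<integral>\<omega>\<in>space M - E. f \<omega> \<partial>M)"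
        by (rule set_integral_Un) (use E that in \<open>auto intro!: si\<close>)
      moreover have "E \<union> (space M - E) = space M" using E sets.sets_into_space by blast
      ultimately show ?thesis by simp
    qed
    then show ?case using compl W(1) intV spW by simp
  next
    case (union E)
    have E: "E i \<in> sets M" for i using HM union by blast
    have "(\<integral>\<omega>\<in>(\<Union>i. E i). f \<omega> \<partial>M) = (\<Sum>i. \<integral>\<omega>\<in>E i. f \<omega> \<partial>M)"
      if "integrable M f" for f :: "'a \<Rightarrow> real"
      by (rule lebesgue_integral_countable_add)
        (use E that union in \<open>auto intro!: si simp: disjoint_family_on_def\<close>)
    then show ?case using union W(1) intV by simp
  qed
  moreover have "V \<in> borel_measurable H"
    using V(1) FH spF spH by (auto simp: measurable_def)
  ultimately have "AE \<omega> in M. real_cond_exp M H W \<omega> = V \<omega>"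
    by (intro H.real_cond_exp_charact W(1) intV)
  then show thesis using that subH FH YH by blast
qed

text \<open>As a function of \<open>Y\<close> and \<open>V\<close>, the factor g is H-measurable and
  can be pulled out of the conditional expectation given \<open>H\<close>, where \<open>W\<close>
  becomes \<open>V\<close>. This orthogonality removes the first-order terms in the Jensen argument,
  with g a derivative of the convex function concerned.\<close>

lemma cond_indep_integral_mult_diff_eq_0:
  fixes X :: "'a \<Rightarrow> 'b::topological_space" and Y :: "'a \<Rightarrow> 'c::topological_space"
  assumes "prob_space M"
    and F: "subalgebra M F" and "subalgebra M G" "sets F \<subseteq> sets G"
    and "G = vimage_algebra (space M) X borel"
    and [measurable]: "Y \<in> borel_measurable M" and "X \<in> borel_measurable M"
    and "cond_indep M F Y X"
    and W: "integrable M W" "W \<in> borel_measurable G"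
    and V: "V \<in> borel_measurable F" "AE \<omega> in M. real_cond_exp M F W \<omega> = V \<omega>"
    and g: "(\<lambda>(y, v). g y v) \<in> borel_measurable (borel \<Otimes>\<^sub>M borel)"
    and gW: "integrable M (\<lambda>\<omega>. g (Y \<omega>) (V \<omega>) * W \<omega>)"
  shows "integrable M (\<lambda>\<omega>. g (Y \<omega>) (V \<omega>) * (W \<omega> - V \<omega>))"
    and "(\<integral>\<omega>. g (Y \<omega>) (V \<omega>) * (W \<omega> - V \<omega>) \<partial>M) = 0"
proof -
  interpret prob_space M by fact
  obtain H where H: "subalgebra M H" "sets F \<subseteq> sets H" "Y \<in> borel_measurable H"
    and WH: "AE \<omega> in M. real_cond_exp M H W \<omega> = V \<omega>"
    using cond_indep_cond_exp[OF assms(1-12)] by blast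
  interpret H: finite_measure_subalgebra M H by standard (fact H)
  have [measurable]: "W \<in> borel_measurable M" "V \<in> borel_measurable M"
    using W(1) measurable_from_subalg[OF F V(1)] by auto
  have "V \<in> borel_measurable H"
    using V(1) H F by (auto simp: measurable_def subalgebra_def)
  with H(3) have "(\<lambda>\<omega>. (Y \<omega>, V \<omega>)) \<in> H \<rightarrow>\<^sub>M borel \<Otimes>\<^sub>M borel" by measurable
  from measurable_compose[OF this g]
  have gH: "(\<lambda>\<omega>. g (Y \<omega>) (V \<omega>)) \<in> borel_measurable H" by simp
  have [measurable]: "(\<lambda>\<omega>. g (Y \<omega>) (V \<omega>)) \<in> borel_measurable M"
    by (rule measurable_from_subalg[OF H(1) gH])
  note cW = H.real_cond_exp_intg[OF gW gH borel_measurable_integrable[OF W(1)]]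
  \<comment> \<open>Integrability of g V is inherited from that of g W through the conditional
    expectation given \<open>H\<close>.\<close>
  have gV: "integrable M (\<lambda>\<omega>. g (Y \<omega>) (V \<omega>) * V \<omega>)"
    by (rule integrable_cong_AE_imp[OF cW(1)]) (use WH in auto)
  have "(\<integral>\<omega>. g (Y \<omega>) (V \<omega>) * V \<omega> \<partial>M) = (\<integral>\<omega>. g (Y \<omega>) (V \<omega>) * real_cond_exp M H W \<omega> \<partial>M)"
    by (rule integral_cong_AE) (use WH in auto)
  with cW(2) gV gW
  show "integrable M (\<lambda>\<omega>. g (Y \<omega>) (V \<omega>) * (W \<omega> - V \<omega>))"
    and "(\<integral>\<omega>. g (Y \<omega>) (V \<omega>) * (W \<omega> - V \<omega>) \<partial>M) = 0"
    by (simp_all add: right_diff_distrib)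
qed

section \<open>The asymmetric least squares objective\<close>

text \<open>The derivative of \<open>als_loss\<close> in its second argument; both branches vanish
  at 0, so the loss is differentiable there too.\<close>

definition als_grad :: "real \<Rightarrow> real \<Rightarrow> real" where
  "als_grad \<tau> c = (if c \<le> 0 then 2 * (1 - \<tau>) * c else 2 * \<tau> * c)"

lemma als_loss_ge_tangent:
  assumes "0 < \<tau>" "\<tau> < 1"
  shows "als_loss \<tau> a + als_grad \<tau> a * (b - a) \<le> als_loss \<tau> b"
proof -
  have sq: "0 \<le> t * (b - a)\<^sup>2" if "0 < t" for t :: real using that by simp
  have tb: "0 \<le> \<tau> * b\<^sup>2" "0 \<le> (1 - \<tau>) * b\<^sup>2" "0 \<le> \<tau> * a\<^sup>2" "0 \<le> (1 - \<tau>) * a\<^sup>2"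
    using assms by simp_all
  consider "a \<le> 0" "b \<le> 0" | "a \<le> 0" "b > 0" | "a > 0" "b \<le> 0" | "a > 0" "b > 0" by linarith
  then show ?thesis
  proof cases
    case 1
    then show ?thesis using sq[of "1 - \<tau>"] assms
      by (simp add: als_loss_def als_grad_def power2_eq_square algebra_simps)
  next
    case 2
    \<comment> \<open>With t the weight of the branch of a, the tangent at a takes the value t (2 a
      b - a^2) at b. For opposite signs this is at most 0, while the loss is nonnegative; for equal
      signs the gap is t (b - a)^2.\<close>
    then have "0 \<le> (1 - \<tau>) * (- a * b)" using assms by (intro mult_nonneg_nonneg) auto
    with 2 tb show ?thesis
      by (simp add: als_loss_def als_grad_def power2_eq_square algebra_simps)
  next
    case 3
    then have "0 \<le> \<tau> * (a * - b)" using assms by (intro mult_nonneg_nonneg) auto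
    with 3 tb show ?thesis
      by (simp add: als_loss_def als_grad_def power2_eq_square algebra_simps)
  next
    case 4
    then show ?thesis using sq[of \<tau>] assms
      by (simp add: als_loss_def als_grad_def power2_eq_square algebra_simps)
  qed
qed

text \<open>Since the weight t lies in (0, 1), 4 t^2 c^2 is at most 4 t c^2. Finite expected loss
  thus makes the derivative square integrable, and its product with a projection of \<open>X\<close>
  integrable.\<close>

lemma als_grad_sq_le:
  assumes "0 < \<tau>" "\<tau> < 1"
  shows "(als_grad \<tau> c)\<^sup>2 \<le> 4 * als_loss \<tau> c"
proof -
  have "(2 * t * c)\<^sup>2 \<le> 4 * (t * c\<^sup>2)" if "0 < t" "t < 1" for t :: real
  proof -
    have "t\<^sup>2 * c\<^sup>2 \<le> t * c\<^sup>2"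
      using that by (intro mult_right_mono) (auto simp: power2_eq_square mult_le_one)
    then show ?thesis by (simp add: power_mult_distrib)
  qed
  from this[of \<tau>] this[of "1 - \<tau>"] show ?thesis
    using assms by (simp add: als_grad_def als_loss_def)
qed

lemma als_grad_measurable [measurable]: "als_grad \<tau> \<in> borel_measurable borel"
  unfolding als_grad_def by measurable

section \<open>Second moments, and Jensen's inequality for both summands of the objective\<close>

lemma abs_mult_le_sum_sq: "\<bar>a * b\<bar> \<le> a\<^sup>2 + (b :: real)\<^sup>2"
proof -
  have "2 * (\<bar>a\<bar> * \<bar>b\<bar>) \<le> \<bar>a\<bar>\<^sup>2 + \<bar>b\<bar>\<^sup>2" using sum_squares_bound[of "\<bar>a\<bar>" "\<bar>b\<bar>"] by simp
  moreover have "0 \<le> \<bar>a\<bar> * \<bar>b\<bar>" by simp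
  ultimately show ?thesis unfolding abs_mult power2_abs by linarith
qed

lemma integrable_mult_of_sq:
  fixes f g :: "'a \<Rightarrow> real"
  assumes "f \<in> borel_measurable M" "g \<in> borel_measurable M"
    and "integrable M (\<lambda>\<omega>. (f \<omega>)\<^sup>2)" "integrable M (\<lambda>\<omega>. (g \<omega>)\<^sup>2)"
  shows "integrable M (\<lambda>\<omega>. f \<omega> * g \<omega>)"
  by (rule Bochner_Integration.integrable_bound[OF Bochner_Integration.integrable_add[OF assms(3,4)]])
    (use assms abs_mult_le_sum_sq in \<open>auto intro!: AE_I2\<close>)

lemma integrable_inner_centered_sq:
  fixes X :: "'a \<Rightarrow> real ^ 'p"
  assumes "prob_space M" and [measurable]: "X \<in> borel_measurable M"
    and "integrable M (\<lambda>\<omega>. (norm (X \<omega>))\<^sup>2)"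
  shows "integrable M (\<lambda>\<omega>. (v \<bullet> (X \<omega> - m))\<^sup>2)"
proof (rule Bochner_Integration.integrable_bound)
  interpret prob_space M by fact
  \<comment> \<open>The dominating function comes from Cauchy-Schwarz and (s + t)^2 \<le> 2 s^2 + 2
    t^2.\<close>
  show "integrable M (\<lambda>\<omega>. (norm v)\<^sup>2 * (2 * (norm (X \<omega>))\<^sup>2 + 2 * (norm m)\<^sup>2))"
    using assms(3) by simp
  have "(v \<bullet> (x - m))\<^sup>2 \<le> (norm v)\<^sup>2 * (2 * (norm x)\<^sup>2 + 2 * (norm m)\<^sup>2)" for x
  proof -
    have "(v \<bullet> (x - m))\<^sup>2 = \<bar>v \<bullet> (x - m)\<bar>\<^sup>2" by simp
    also have "\<dots> \<le> (norm v * norm (x - m))\<^sup>2"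
      by (intro power_mono Cauchy_Schwarz_ineq2) simp
    also have "\<dots> \<le> (norm v * (norm x + norm m))\<^sup>2"
      by (intro power_mono mult_left_mono norm_triangle_ineq4) auto
    also have "\<dots> \<le> (norm v)\<^sup>2 * (2 * (norm x)\<^sup>2 + 2 * (norm m)\<^sup>2)"
      unfolding power_mult_distrib using sum_squares_bound[of "norm x" "norm m"]
      by (intro mult_left_mono) (auto simp: power2_sum)
    finally show ?thesis .
  qed
  then show "AE \<omega> in M. norm ((v \<bullet> (X \<omega> - m))\<^sup>2)
      \<le> norm ((norm v)\<^sup>2 * (2 * (norm (X \<omega>))\<^sup>2 + 2 * (norm m)\<^sup>2))"
    by auto
qed simp

text \<open>Expanding the square into products of centered coordinates gives the entries of the
  covariance matrix. The penalty thereby becomes an expectation of a convex function of the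
  projection, like the loss term.\<close>

lemma covariance_matrix_quadratic_form:
  fixes X :: "'a \<Rightarrow> real ^ 'p"
  assumes "prob_space M" and X [measurable]: "X \<in> borel_measurable M"
    and "integrable M (\<lambda>\<omega>. (norm (X \<omega>))\<^sup>2)"
  shows "v \<bullet> (covariance_matrix M X *v v) = (\<integral>\<omega>. (v \<bullet> (X \<omega> - integral\<^sup>L M X))\<^sup>2 \<partial>M)"
proof -
  define Z where "Z = (\<lambda>i \<omega>. axis i 1 \<bullet> (X \<omega> - integral\<^sup>L M X))"
  have Z: "Z i \<omega> = X \<omega> $ i - integral\<^sup>L M X $ i" for i \<omega>
    by (simp add: Z_def inner_axis')
  have [measurable]: "Z i \<in> borel_measurable M" for i unfolding Z_def by measurable
  have "integrable M (\<lambda>\<omega>. (Z i \<omega>)\<^sup>2)" for i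
    unfolding Z_def by (rule integrable_inner_centered_sq[OF assms])
  then have ZZ: "integrable M (\<lambda>\<omega>. Z i \<omega> * Z j \<omega>)" for i j
    by (intro integrable_mult_of_sq) auto
  have "(v \<bullet> (X \<omega> - integral\<^sup>L M X))\<^sup>2 = (\<Sum>i\<in>UNIV. \<Sum>j\<in>UNIV. v $ i * v $ j * (Z i \<omega> * Z j \<omega>))" for \<omega>
    by (simp add: inner_vec_def power2_eq_square sum_product Z mult_ac)
  then have "(\<integral>\<omega>. (v \<bullet> (X \<omega> - integral\<^sup>L M X))\<^sup>2 \<partial>M)
      = (\<Sum>i\<in>UNIV. \<Sum>j\<in>UNIV. v $ i * v $ j * (\<integral>\<omega>. Z i \<omega> * Z j \<omega> \<partial>M))"
    using ZZ by simp
  also have "\<dots> = v \<bullet> (covariance_matrix M X *v v)"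
    by (simp add: inner_vec_def matrix_vector_mult_def covariance_matrix_def Let_def Z
        sum_distrib_left mult_ac)
  finally show ?thesis by simp
qed

text \<open>Jensen's inequality conditional on \<open>(Y, B\<^sup>T X)\<close>, in tangent-line form, for both summands.\<close>

lemma als_objective_projection_le:
  fixes X :: "'a \<Rightarrow> real ^ 'p"
  assumes ps: "prob_space M"
    and F: "subalgebra M F" and G: "subalgebra M G" "sets F \<subseteq> sets G"
    and G_def: "G = vimage_algebra (space M) X borel"
    and Y [measurable]: "Y \<in> borel_measurable M" and X [measurable]: "X \<in> borel_measurable M"
    and ci: "cond_indep M F Y X"
    and X2: "integrable M (\<lambda>\<omega>. (norm (X \<omega>))\<^sup>2)"
    and lam: "lam > 0" and \<tau>: "0 < \<tau>" "\<tau> < 1"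
    and \<mu>: "\<mu> = integral\<^sup>L M X"
    and loss: "\<And>\<beta>. integrable M (\<lambda>\<omega>. als_loss \<tau> (Y \<omega> - \<alpha> - \<beta> \<bullet> (X \<omega> - \<mu>)))"
    and V: "(\<lambda>\<omega>. \<gamma> \<bullet> (X \<omega> - \<mu>)) \<in> borel_measurable F"
      "AE \<omega> in M. real_cond_exp M F (\<lambda>\<omega>. \<beta> \<bullet> (X \<omega> - \<mu>)) \<omega> = \<gamma> \<bullet> (X \<omega> - \<mu>)"
  shows "als_objective M Y X lam \<tau> (\<alpha>, \<gamma>) \<le> als_objective M Y X lam \<tau> (\<alpha>, \<beta>)"
proof -
  interpret prob_space M by fact
  define W where "W = (\<lambda>\<omega>. \<beta> \<bullet> (X \<omega> - \<mu>))"
  define V where "V = (\<lambda>\<omega>. \<gamma> \<bullet> (X \<omega> - \<mu>))"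
  have V': "V \<in> borel_measurable F" "AE \<omega> in M. real_cond_exp M F W \<omega> = V \<omega>"
    using V by (simp_all add: V_def W_def)
  have [measurable]: "W \<in> borel_measurable M" "V \<in> borel_measurable M"
    unfolding W_def V_def by measurable
  have W2: "integrable M (\<lambda>\<omega>. (W \<omega>)\<^sup>2)" and V2: "integrable M (\<lambda>\<omega>. (V \<omega>)\<^sup>2)"
    unfolding W_def V_def using integrable_inner_centered_sq[OF ps X X2] by auto
  have W1: "integrable M W"
    by (rule square_integrable_imp_integrable) (use W2 in auto)
  have "X \<in> borel_measurable G" unfolding G_def by (rule measurable_vimage_algebra1) auto
  then have WG: "W \<in> borel_measurable G" unfolding W_def by measurable
  define r where "r = (\<lambda>\<omega>. Y \<omega> - \<alpha> - V \<omega>)"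
  have r: "r \<omega> = Y \<omega> - \<alpha> - V \<omega>" for \<omega> by (simp add: r_def)
  have [measurable]: "r \<in> borel_measurable M" unfolding r_def by measurable
  \<comment> \<open>Finite expected loss is assumed at every slope, in particular at \<gamma>, whose
    residual is \<open>r\<close>.\<close>
  have g2: "integrable M (\<lambda>\<omega>. (als_grad \<tau> (r \<omega>))\<^sup>2)"
  proof (rule Bochner_Integration.integrable_bound)
    show "integrable M (\<lambda>\<omega>. 4 * als_loss \<tau> (r \<omega>))"
      using loss[of \<gamma>] by (simp add: r_def V_def)
    show "AE \<omega> in M. norm ((als_grad \<tau> (r \<omega>))\<^sup>2) \<le> norm (4 * als_loss \<tau> (r \<omega>))"
      using als_grad_sq_le[OF \<tau>] by (intro AE_I2) (simp add: order_trans[OF _ abs_ge_self])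
  qed measurable
  note zero = cond_indep_integral_mult_diff_eq_0[OF ps F G G_def Y X ci W1 WG V']
  have gm: "(\<lambda>(y, v). als_grad \<tau> (y - \<alpha> - v)) \<in> borel_measurable (borel \<Otimes>\<^sub>M borel)"
    by measurable
  have "integrable M (\<lambda>\<omega>. als_grad \<tau> (Y \<omega> - \<alpha> - V \<omega>) * W \<omega>)"
    using g2 W2 by (intro integrable_mult_of_sq) (auto simp: r_def)
  note gz = zero[OF gm this, unfolded r[symmetric]]
  have "integrable M (\<lambda>\<omega>. 2 * V \<omega> * W \<omega>)"
    using V2 W2 by (intro integrable_mult_of_sq) (auto simp: power_mult_distrib)
  note vz = zero[of "\<lambda>y v. 2 * v", OF _ this]
  have lossW: "integrable M (\<lambda>\<omega>. als_loss \<tau> (Y \<omega> - \<alpha> - W \<omega>))"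
    and lossV: "integrable M (\<lambda>\<omega>. als_loss \<tau> (r \<omega>))"
    using loss by (auto simp: W_def r_def V_def)
  \<comment> \<open>The subtracted term has mean zero. The new integrand is the tangent at
    \<open>r\<close> evaluated at the residual for \<beta>, which differs from \<open>r\<close> by
    -(W - V).\<close>
  have "(\<integral>\<omega>. als_loss \<tau> (r \<omega>) \<partial>M)
      = (\<integral>\<omega>. als_loss \<tau> (r \<omega>) - als_grad \<tau> (r \<omega>) * (W \<omega> - V \<omega>) \<partial>M)"
    using gz lossV by simp
  also have "\<dots> \<le> (\<integral>\<omega>. als_loss \<tau> (Y \<omega> - \<alpha> - W \<omega>) \<partial>M)"
  proof (rule integral_mono)
    fix \<omega>
    show "als_loss \<tau> (r \<omega>) - als_grad \<tau> (r \<omega>) * (W \<omega> - V \<omega>) \<le> als_loss \<tau> (Y \<omega> - \<alpha> - W \<omega>)"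
      using als_loss_ge_tangent[OF \<tau>, of "r \<omega>" "Y \<omega> - \<alpha> - W \<omega>"]
      by (simp add: r_def algebra_simps)
  qed (use gz lossV lossW in auto)
  finally have 1: "(\<integral>\<omega>. als_loss \<tau> (r \<omega>) \<partial>M) \<le> (\<integral>\<omega>. als_loss \<tau> (Y \<omega> - \<alpha> - W \<omega>) \<partial>M)" .
  \<comment> \<open>The same argument for the square, whose derivative at V is 2 V; the gap to W^2
    is (W - V)^2.\<close>
  have "(\<integral>\<omega>. (V \<omega>)\<^sup>2 \<partial>M) = (\<integral>\<omega>. (V \<omega>)\<^sup>2 + 2 * V \<omega> * (W \<omega> - V \<omega>) \<partial>M)"
    using vz V2 by simp
  also have "\<dots> \<le> (\<integral>\<omega>. (W \<omega>)\<^sup>2 \<partial>M)"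
  proof (rule integral_mono)
    fix \<omega>
    show "(V \<omega>)\<^sup>2 + 2 * V \<omega> * (W \<omega> - V \<omega>) \<le> (W \<omega>)\<^sup>2"
      using zero_le_power2[of "W \<omega> - V \<omega>"] by (simp add: power2_eq_square algebra_simps)
  qed (use vz V2 W2 in auto)
  finally have 2: "(\<integral>\<omega>. (V \<omega>)\<^sup>2 \<partial>M) \<le> (\<integral>\<omega>. (W \<omega>)\<^sup>2 \<partial>M)" .
  from 2 mult_left_mono[OF 1 less_imp_le[OF lam]] show ?thesis
    unfolding als_objective_def prod.case covariance_matrix_quadratic_form[OF ps X X2]
      \<mu>[symmetric] r_def W_def V_def by linarith
qed

section \<open>The linear conditional mean and the span of the minimizers\<close>

text \<open>Linearity of conditional expectation turns the coordinatewise formula into an affine one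
  for \<beta> \<bullet> X. Taking expectations determines its intercept, which cancels once
  \<open>X\<close> is centered.\<close>

lemma linear_cond_mean_projection:
  fixes X :: "'a \<Rightarrow> real ^ 'p"
  assumes "prob_space M" and F: "subalgebra M (sigma_proj M X d B)"
    and X: "integrable M X" and "linear_cond_mean M X d B"
  obtains \<gamma> where "\<gamma> \<in> col_space d B"
    "(\<lambda>\<omega>. \<gamma> \<bullet> (X \<omega> - integral\<^sup>L M X)) \<in> borel_measurable (sigma_proj M X d B)"
    "AE \<omega> in M. real_cond_exp M (sigma_proj M X d B) (\<lambda>\<omega>. \<beta> \<bullet> (X \<omega> - integral\<^sup>L M X)) \<omega>
      = \<gamma> \<bullet> (X \<omega> - integral\<^sup>L M X)"
proof -
  interpret prob_space M by fact
  let ?F = "sigma_proj M X d B" and ?\<mu> = "integral\<^sup>L M X"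
  interpret F: finite_measure_subalgebra M ?F by standard (fact F)
  obtain c A where cA: "\<And>i. AE \<omega> in M. real_cond_exp M ?F (\<lambda>\<omega>. X \<omega> $ i) \<omega>
      = c $ i + (\<Sum>j<d. A j $ i * (B j \<bullet> X \<omega>))"
    using assms(4) unfolding linear_cond_mean_def by blast
  have Xi: "integrable M (\<lambda>\<omega>. X \<omega> $ i)" for i using integrable_bounded_linear[OF bounded_linear_vec_nth X] .
  \<comment> \<open>In matrix notation \<gamma> is B A^T \<beta>, read off from \<beta>^T A B^T X =
    \<gamma>^T X.\<close>
  define \<gamma> where "\<gamma> = (\<Sum>j<d. (\<beta> \<bullet> A j) *\<^sub>R B j)"
  have \<gamma>_in: "\<gamma> \<in> col_space d B"
    unfolding \<gamma>_def col_space_def by (intro span_sum span_scale span_base) auto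
  have "(\<lambda>\<omega>. \<gamma> \<bullet> X \<omega>) \<in> borel_measurable ?F"
    unfolding \<gamma>_def inner_sum_left inner_scaleR_left
    by (intro borel_measurable_sum borel_measurable_times borel_measurable_const
        inner_measurable_sigma_proj) simp
  then have \<gamma>_meas: "(\<lambda>\<omega>. \<gamma> \<bullet> (X \<omega> - ?\<mu>)) \<in> borel_measurable ?F"
    unfolding inner_diff_right by simp
  have "AE \<omega> in M. real_cond_exp M ?F (\<lambda>\<omega>. \<Sum>i\<in>UNIV. \<beta> $ i * X \<omega> $ i) \<omega>
      = (\<Sum>i\<in>UNIV. real_cond_exp M ?F (\<lambda>\<omega>. \<beta> $ i * X \<omega> $ i) \<omega>)"
    using Xi by (intro F.real_cond_exp_sum) auto
  moreover have "AE \<omega> in M. \<forall>i. real_cond_exp M ?F (\<lambda>\<omega>. \<beta> $ i * X \<omega> $ i) \<omega>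
      = \<beta> $ i * real_cond_exp M ?F (\<lambda>\<omega>. X \<omega> $ i) \<omega>"
    using Xi by (intro eventually_all_finite F.real_cond_exp_cmult) auto
  moreover have "AE \<omega> in M. \<forall>i. real_cond_exp M ?F (\<lambda>\<omega>. X \<omega> $ i) \<omega>
      = c $ i + (\<Sum>j<d. A j $ i * (B j \<bullet> X \<omega>))"
    using cA by (intro eventually_all_finite) auto
  ultimately have cond: "AE \<omega> in M. real_cond_exp M ?F (\<lambda>\<omega>. \<beta> \<bullet> X \<omega>) \<omega> = \<beta> \<bullet> c + \<gamma> \<bullet> X \<omega>"
  proof eventually_elim
    case (elim \<omega>)
    have "real_cond_exp M ?F (\<lambda>\<omega>. \<beta> \<bullet> X \<omega>) \<omega>
        = (\<Sum>i\<in>UNIV. \<beta> $ i * (c $ i + (\<Sum>j<d. A j $ i * (B j \<bullet> X \<omega>))))"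
      using elim by (simp add: inner_vec_def)
    also have "\<dots> = \<beta> \<bullet> c + (\<Sum>i\<in>UNIV. \<Sum>j<d. \<beta> $ i * (A j $ i * (B j \<bullet> X \<omega>)))"
      by (simp add: inner_vec_def distrib_left sum.distrib sum_distrib_left)
    also have "(\<Sum>i\<in>UNIV. \<Sum>j<d. \<beta> $ i * (A j $ i * (B j \<bullet> X \<omega>)))
        = (\<Sum>j<d. \<Sum>i\<in>UNIV. \<beta> $ i * (A j $ i * (B j \<bullet> X \<omega>)))"
      by (rule sum.swap)
    also have "\<dots> = (\<Sum>j<d. (\<beta> \<bullet> A j) * (B j \<bullet> X \<omega>))"
      by (intro sum.cong refl) (simp add: inner_vec_def[of \<beta>] sum_distrib_right mult.assoc)
    also have "\<dots> = \<gamma> \<bullet> X \<omega>" by (simp add: \<gamma>_def inner_sum_left)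
    finally show ?case .
  qed
  have int: "integrable M (\<lambda>\<omega>. v \<bullet> X \<omega>)" for v using X by simp
  \<comment> \<open>The tower property identifies the intercept \<beta> \<bullet> c as the
    difference of the means of \<beta> \<bullet> X and \<gamma> \<bullet> X.\<close>
  have "\<beta> \<bullet> ?\<mu> = (\<integral>\<omega>. real_cond_exp M ?F (\<lambda>\<omega>. \<beta> \<bullet> X \<omega>) \<omega> \<partial>M)"
    using F.real_cond_exp_int(2)[OF int[of \<beta>]] X by simp
  also have "\<dots> = (\<integral>\<omega>. \<beta> \<bullet> c + \<gamma> \<bullet> X \<omega> \<partial>M)"
    by (rule integral_cong_AE) (use cond int in auto)
  also have "\<dots> = \<beta> \<bullet> c + \<gamma> \<bullet> ?\<mu>" using X by (simp add: prob_space)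
  finally have mean: "\<beta> \<bullet> ?\<mu> = \<beta> \<bullet> c + \<gamma> \<bullet> ?\<mu>" .
  have "AE \<omega> in M. real_cond_exp M ?F (\<lambda>\<omega>. \<beta> \<bullet> X \<omega> - \<beta> \<bullet> ?\<mu>) \<omega>
      = real_cond_exp M ?F (\<lambda>\<omega>. \<beta> \<bullet> X \<omega>) \<omega> - real_cond_exp M ?F (\<lambda>\<omega>. \<beta> \<bullet> ?\<mu>) \<omega>"
    using int by (intro F.real_cond_exp_diff) auto
  moreover have "AE \<omega> in M. real_cond_exp M ?F (\<lambda>\<omega>. \<beta> \<bullet> ?\<mu>) \<omega> = \<beta> \<bullet> ?\<mu>"
    by (intro F.real_cond_exp_F_meas) auto
  ultimately have "AE \<omega> in M. real_cond_exp M ?F (\<lambda>\<omega>. \<beta> \<bullet> (X \<omega> - ?\<mu>)) \<omega> = \<gamma> \<bullet> (X \<omega> - ?\<mu>)"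
    using cond by eventually_elim (use mean in \<open>simp add: inner_diff_right\<close>)
  with that \<gamma>_in \<gamma>_meas show thesis by blast
qed

text \<open>Column j of u v^T is the multiple of u by the j-th entry of v, so every column of the
  sum is a linear combination of the vectors \<open>u k\<close>.\<close>

lemma span_columns_sum_outer_product_subset:
  assumes "subspace S" and "\<And>k. k \<in> I \<Longrightarrow> u k \<in> S"
  shows "span (columns (\<Sum>k\<in>I. outer_product (u k) (v k))) \<subseteq> S"
proof (rule span_minimal[OF _ assms(1)], rule subsetI)
  fix x assume "x \<in> columns (\<Sum>k\<in>I. outer_product (u k) (v k))"
  then obtain j where "x = column j (\<Sum>k\<in>I. outer_product (u k) (v k))"
    by (auto simp: columns_def)
  then have "x = (\<Sum>k\<in>I. (v k $ j) *\<^sub>R u k)"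
    by (simp add: vec_eq_iff column_def outer_product_def mult.commute)
  then show "x \<in> S" using assms by (auto intro!: subspace_sum subspace_scale)
qed

theorem corollary1:
  fixes M :: "'a measure"
    and Y :: "'a \<Rightarrow> real"
    and X :: "'a \<Rightarrow> real ^ 'p"
    and lam :: real
    and d K :: nat
    and B :: "nat \<Rightarrow> real ^ 'p"
    and \<tau> \<alpha>\<^sub>0 :: "nat \<Rightarrow> real"
    and \<beta>\<^sub>0 :: "nat \<Rightarrow> real ^ 'p"
  assumes "prob_space M"
    and "Y \<in> borel_measurable M"
    and "X \<in> borel_measurable M"
    and "integrable M (\<lambda>\<omega>. (norm (X \<omega>))\<^sup>2)"
    and "lam > 0"
    and "dim_reduction_space M Y X (central_space M Y X)"
    and "cols_basis d B (central_space M Y X)"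
    and "linear_cond_mean M X d B"
    and "K \<ge> 1"
    and "\<And>k. k \<in> {1..K} \<Longrightarrow> 0 < \<tau> k \<and> \<tau> k < 1"
    and "strict_mono_on {1..K} \<tau>"
    and "\<And>k \<alpha> \<beta>. k \<in> {1..K} \<Longrightarrow>
      integrable M (\<lambda>\<omega>. als_loss (\<tau> k) (Y \<omega> - \<alpha> - \<beta> \<bullet> (X \<omega> - integral\<^sup>L M X)))"
    and "\<And>k. k \<in> {1..K} \<Longrightarrow>
      \<exists>!z. is_arg_min (als_objective M Y X lam (\<tau> k)) (\<lambda>_. True) z"
    and "\<And>k. k \<in> {1..K} \<Longrightarrow>
      (\<alpha>\<^sub>0 k, \<beta>\<^sub>0 k) = arg_min (als_objective M Y X lam (\<tau> k)) (\<lambda>_. True)"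
  shows "span (columns (\<Sum>k=1..K. outer_product (\<beta>\<^sub>0 k) (\<beta>\<^sub>0 k))) \<subseteq> central_space M Y X"
proof -
  let ?F = "sigma_proj M X d B" and ?\<mu> = "integral\<^sup>L M X" and ?S = "central_space M Y X"
  interpret prob_space M by fact
  note X = \<open>X \<in> borel_measurable M\<close>
  have S: "?S = col_space d B" using assms(7) by (simp add: cols_basis_def)
  \<comment> \<open>The columns that witness the dimension reduction space may differ from
    \<open>B\<close>, even in number; only their span is the same.\<close>
  obtain d' B' where "?S = col_space d' B'" and "cond_indep M (sigma_proj M X d' B') Y X"
    using assms(6) unfolding dim_reduction_space_def by blast
  then have ci: "cond_indep M ?F Y X"
    using S sigma_proj_eq_span[of d B d' B' M X] by simp
  define G where "G = vimage_algebra (space M) X borel"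
  have subG: "subalgebra M G"
    using sets_image_in_sets[OF refl X] by (simp add: subalgebra_def G_def)
  have FG: "sets ?F \<subseteq> sets G" unfolding G_def by (rule sets_sigma_proj_subset)
  then have subF: "subalgebra M ?F"
    using subG by (auto simp: subalgebra_def sigma_proj_def)
  have intX: "integrable M X"
  proof (rule Bochner_Integration.integrable_bound)
    show "integrable M (\<lambda>\<omega>. 1 + (norm (X \<omega>))\<^sup>2)" using assms(4) by simp
    have "norm x \<le> 1 + (norm x)\<^sup>2" for x :: "real ^ 'p"
      using abs_mult_le_sum_sq[of 1 "norm x"] by simp
    then show "AE \<omega> in M. norm (X \<omega>) \<le> norm (1 + (norm (X \<omega>))\<^sup>2)"
      by (intro AE_I2) (simp add: abs_of_nonneg add_nonneg_nonneg)
  qed (fact X)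
  have "\<beta>\<^sub>0 k \<in> ?S" if k: "k \<in> {1..K}" for k
  proof -
    let ?L = "als_objective M Y X lam (\<tau> k)"
    \<comment> \<open>\<open>arg_min\<close> is a Hilbert choice, so that it minimizes at all rests
      on the assumed existence of a minimizer.\<close>
    have min: "is_arg_min ?L (\<lambda>_. True) (\<alpha>\<^sub>0 k, \<beta>\<^sub>0 k)"
      unfolding assms(14)[OF k] arg_min_def by (rule someI_ex) (use assms(13)[OF k] in blast)
    obtain \<gamma> where \<gamma>: "\<gamma> \<in> col_space d B"
      "(\<lambda>\<omega>. \<gamma> \<bullet> (X \<omega> - ?\<mu>)) \<in> borel_measurable ?F"
      "AE \<omega> in M. real_cond_exp M ?F (\<lambda>\<omega>. \<beta>\<^sub>0 k \<bullet> (X \<omega> - ?\<mu>)) \<omega> = \<gamma> \<bullet> (X \<omega> - ?\<mu>)"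
      using linear_cond_mean_projection[OF assms(1) subF intX assms(8)] by blast
    have "?L (\<alpha>\<^sub>0 k, \<gamma>) \<le> ?L (\<alpha>\<^sub>0 k, \<beta>\<^sub>0 k)"
      using assms(10)[OF k]
      by (intro als_objective_projection_le[OF assms(1) subF subG FG G_def assms(2,3) ci
            assms(4,5) _ _ refl assms(12)[OF k] \<gamma>(2,3)]) auto
    \<comment> \<open>A point whose value does not exceed the minimum is itself a minimizer, so
      uniqueness identifies the slopes.\<close>
    then have "is_arg_min ?L (\<lambda>_. True) (\<alpha>\<^sub>0 k, \<gamma>)"
      by (rule is_arg_min_antimono[OF min]) simp
    with min assms(13)[OF k] have "\<beta>\<^sub>0 k = \<gamma>" by blast
    with \<gamma>(1) S show ?thesis by simp
  qed
  then show ?thesis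
    by (intro span_columns_sum_outer_product_subset) (auto simp: S col_space_def)
qed

end
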